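(* Let $\varepsilon,p$ be two real numbers such that $0<\varepsilon<2d$ and $p\ge1$. Then there is a nonnegative constant $M_{\varepsilon,p}$ such that for every quaternion window function $g$, every $f\in L^2(\mathbb{R}^{2d},\mathbb{H})$ and every measurable subset $\Sigma$ of $\mathbb{R}^{2d}\times\mathbb{R}^{2d}$ of finite measure, $$\|\chi_\Sigma A(f,g)\|_{p,4d}^{p(p+1)}\le M_{\varepsilon,p}\;\mu_{4d}(\Sigma)\;\big\||(x,w)|^\varepsilon A(f,g)\big\|_{2,4d}^{\frac{4pd}{2d+\varepsilon}}\big(\|f\|_{2,2d}\|g\|_{2,2d}\big)^{p\left(p-\frac{2d-\varepsilon}{2d+\varepsilon}\right)},$$ where $$M_{\varepsilon,p}=\left(\frac{2d+\varepsilon}{2^{\frac{\varepsilon(2d+2p+2)}{(2d+\varepsilon)(p+1)}}\,\varepsilon^{\frac{2\varepsilon}{2d+\varepsilon}}\,\Gamma(2d)^{\frac{\varepsilon}{(2d+\varepsilon)(p+1)}}\,(2d-\varepsilon)^{\frac{2d-\varepsilon}{2d+\varepsilon}+\frac{\varepsilon}{(2d+\varepsilon)(p+1)}}}\right)^{p(p+1)}.$$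
   Context: $d\ge 1$ is an integer and $\mathbb{H}$ is the algebra of quaternions with units $i,j,k$. On $\mathbb{R}^n$, $d\mu_n(x)=dx/(2\pi)^{n/2}$, $\|F\|_{p,n}=\big(\int_{\mathbb{R}^n}|F|^pd\mu_n\big)^{1/p}\in[0,\infty]$, and $\mathbb{R}^{2d}\times\mathbb{R}^{2d}$ is identified with $\mathbb{R}^{4d}$; $|(x,w)|$ is the Euclidean norm on $\mathbb{R}^{4d}$ and $\chi_\Sigma$ the indicator function of $\Sigma$. A quaternion window function is a non-zero $g\in L^2(\mathbb{R}^{2d},\mathbb{H})$. The radar quaternion ambiguity function is $$A(f,g)(x,w)=\int_{\mathbb{R}^{2d}}e^{-i\,t_1\cdot w_1}f\big(t+\tfrac x2\big)\overline{g\big(t-\tfrac x2\big)}e^{-j\,t_2\cdot w_2}\,d\mu_{2d}(t),\quad x\in\mathbb{R}^{2d},\ w=(w_1,w_2),\ t=(t_1,t_2)\in\mathbb{R}^d\times\mathbb{R}^d.$$ Convention: $0\cdot\infty=0$. *)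

theory Defs
  imports "HOL-Analysis.Analysis"
begin

section \<open>Quaternions\<close>

datatype quaternion = Quaternion (qre: real) (qim_i: real) (qim_j: real) (qim_k: real)

lemma quaternion_eq_iff:
  "x = y \<longleftrightarrow> qre x = qre y \<and> qim_i x = qim_i y \<and> qim_j x = qim_j y \<and> qim_k x = qim_k y"
  by (cases x; cases y) simp

instantiation quaternion :: ring_1
begin

definition zero_quaternion_def: "0 = Quaternion 0 0 0 0"

definition one_quaternion_def: "1 = Quaternion 1 0 0 0"

definition plus_quaternion_def:
  "x + y = Quaternion (qre x + qre y) (qim_i x + qim_i y) (qim_j x + qim_j y) (qim_k x + qim_k y)"

definition uminus_quaternion_def:
  "- x = Quaternion (- qre x) (- qim_i x) (- qim_j x) (- qim_k x)"

definition minus_quaternion_def: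
  "x - y = Quaternion (qre x - qre y) (qim_i x - qim_i y) (qim_j x - qim_j y) (qim_k x - qim_k y)"

definition times_quaternion_def:
  "x * y = Quaternion
     (qre x * qre y - qim_i x * qim_i y - qim_j x * qim_j y - qim_k x * qim_k y)
     (qre x * qim_i y + qim_i x * qre y + qim_j x * qim_k y - qim_k x * qim_j y)
     (qre x * qim_j y - qim_i x * qim_k y + qim_j x * qre y + qim_k x * qim_i y)
     (qre x * qim_k y + qim_i x * qim_j y - qim_j x * qim_i y + qim_k x * qre y)"

lemmas quaternion_ring_defs =
  zero_quaternion_def one_quaternion_def plus_quaternion_def uminus_quaternion_def
  minus_quaternion_def times_quaternion_def

instance
  by standard (auto simp: quaternion_ring_defs algebra_simps)

end

lemma quaternion_sel [simp]:
  "qre 0 = 0" "qim_i 0 = 0" "qim_j 0 = 0" "qim_k 0 = 0"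
  "qre 1 = 1" "qim_i 1 = 0" "qim_j 1 = 0" "qim_k 1 = 0"
  "qre (x + y) = qre x + qre y" "qim_i (x + y) = qim_i x + qim_i y"
  "qim_j (x + y) = qim_j x + qim_j y" "qim_k (x + y) = qim_k x + qim_k y"
  "qre (- x) = - qre x" "qim_i (- x) = - qim_i x"
  "qim_j (- x) = - qim_j x" "qim_k (- x) = - qim_k x"
  "qre (x - y) = qre x - qre y" "qim_i (x - y) = qim_i x - qim_i y"
  "qim_j (x - y) = qim_j x - qim_j y" "qim_k (x - y) = qim_k x - qim_k y"
  by (simp_all add: quaternion_ring_defs)

lemma quaternion_sel_times:
  "qre (x * y) = qre x * qre y - qim_i x * qim_i y - qim_j x * qim_j y - qim_k x * qim_k y"
  "qim_i (x * y) = qre x * qim_i y + qim_i x * qre y + qim_j x * qim_k y - qim_k x * qim_j y"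
  "qim_j (x * y) = qre x * qim_j y - qim_i x * qim_k y + qim_j x * qre y + qim_k x * qim_i y"
  "qim_k (x * y) = qre x * qim_k y + qim_i x * qim_j y - qim_j x * qim_i y + qim_k x * qre y"
  by (simp_all add: times_quaternion_def)

instantiation quaternion :: real_algebra_1
begin

definition scaleR_quaternion_def:
  "r *\<^sub>R x = Quaternion (r * qre x) (r * qim_i x) (r * qim_j x) (r * qim_k x)"

instance
  by standard (auto simp: scaleR_quaternion_def quaternion_eq_iff quaternion_sel_times algebra_simps)

end

lemma quaternion_sel_scaleR [simp]:
  "qre (r *\<^sub>R x) = r * qre x" "qim_i (r *\<^sub>R x) = r * qim_i x"
  "qim_j (r *\<^sub>R x) = r * qim_j x" "qim_k (r *\<^sub>R x) = r * qim_k x"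
  by (simp_all add: scaleR_quaternion_def)

instantiation quaternion :: euclidean_space
begin

definition inner_quaternion_def:
  "x \<bullet> y = qre x * qre y + qim_i x * qim_i y + qim_j x * qim_j y + qim_k x * qim_k y"

definition norm_quaternion_def:
  "norm x = sqrt ((qre x)\<^sup>2 + (qim_i x)\<^sup>2 + (qim_j x)\<^sup>2 + (qim_k x)\<^sup>2)"

definition sgn_quaternion_def: "sgn x = (x::quaternion) /\<^sub>R norm x"

definition dist_quaternion_def: "dist x y = norm (x - y :: quaternion)"

definition uniformity_quaternion_def:
  "(uniformity :: (quaternion \<times> quaternion) filter)
     = (INF e\<in>{0 <..}. principal {(x, y). dist x y < e})"

definition open_quaternion_def:
  "open (U :: quaternion set) \<longleftrightarrow>
     (\<forall>x\<in>U. eventually (\<lambda>(x', y). x' = x \<longrightarrow> y \<in> U) uniformity)"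

definition Basis_quaternion_def:
  "Basis = {Quaternion 1 0 0 0, Quaternion 0 1 0 0, Quaternion 0 0 1 0, Quaternion 0 0 0 1}"

instance
proof
  fix x y z :: quaternion and r :: real and U :: "quaternion set"
  show "(x \<bullet> x = 0) = (x = 0)"
    by (auto simp: inner_quaternion_def quaternion_eq_iff add_nonneg_eq_0_iff)
  show "norm x = sqrt (x \<bullet> x)"
    by (simp add: inner_quaternion_def norm_quaternion_def power2_eq_square)
  show "(\<forall>u\<in>Basis. x \<bullet> u = 0) = (x = 0)"
    unfolding quaternion_eq_iff [of x 0] by (auto simp: inner_quaternion_def Basis_quaternion_def)
  show "u \<in> Basis \<Longrightarrow> v \<in> Basis \<Longrightarrow> u \<bullet> v = (if u = v then 1 else 0)"
    for u v :: quaternion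
    unfolding Basis_quaternion_def by (elim insertE emptyE) (simp_all add: inner_quaternion_def)
  show "x \<bullet> y = y \<bullet> x" "(x + y) \<bullet> z = x \<bullet> z + y \<bullet> z" "r *\<^sub>R x \<bullet> y = r * (x \<bullet> y)" "0 \<le> x \<bullet> x"
    by (simp_all add: inner_quaternion_def algebra_simps)
qed (auto simp: Basis_quaternion_def sgn_quaternion_def dist_quaternion_def
       uniformity_quaternion_def open_quaternion_def)

end

definition qcnj :: "quaternion \<Rightarrow> quaternion" where
  "qcnj x = Quaternion (qre x) (- qim_i x) (- qim_j x) (- qim_k x)"

lemma qcnj_sel [simp]:
  "qre (qcnj x) = qre x" "qim_i (qcnj x) = - qim_i x"
  "qim_j (qcnj x) = - qim_j x" "qim_k (qcnj x) = - qim_k x"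
  by (simp_all add: qcnj_def)

lemma norm_power2_quaternion:
  "(norm x)\<^sup>2 = (qre x)\<^sup>2 + (qim_i x)\<^sup>2 + (qim_j x)\<^sup>2 + (qim_k x)\<^sup>2"
  by (simp add: norm_quaternion_def)

lemma quaternion_mult_qcnj: "x * qcnj x = (norm x)\<^sup>2 *\<^sub>R 1" "qcnj x * x = (norm x)\<^sup>2 *\<^sub>R 1"
  unfolding quaternion_eq_iff norm_power2_quaternion quaternion_sel_times
    quaternion_sel quaternion_sel_scaleR qcnj_sel
  by (intro conjI; algebra)+

instantiation quaternion :: real_normed_div_algebra
begin

definition inverse_quaternion_def: "inverse x = qcnj x /\<^sub>R (norm x)\<^sup>2"

definition divide_quaternion_def: "x div y = x * inverse (y::quaternion)"

instance
proof
  fix x y :: quaternion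
  show "x \<noteq> 0 \<Longrightarrow> inverse x * x = 1" "x \<noteq> 0 \<Longrightarrow> x * inverse x = 1"
    by (simp_all add: inverse_quaternion_def quaternion_mult_qcnj)
  show "norm (x * y) = norm x * norm y"
    unfolding norm_quaternion_def real_sqrt_mult [symmetric]
    by (simp add: quaternion_sel_times power2_eq_square algebra_simps)
qed (simp_all add: inverse_quaternion_def divide_quaternion_def)

end

definition quat_i :: quaternion where "quat_i = Quaternion 0 1 0 0"

definition quat_j :: quaternion where "quat_j = Quaternion 0 0 1 0"

definition quat_k :: quaternion where "quat_k = Quaternion 0 0 0 1"

lemma quat_units:
  "quat_i * quat_i = - 1" "quat_j * quat_j = - 1" "quat_k * quat_k = - 1"
  "quat_i * quat_j = quat_k" "quat_j * quat_k = quat_i" "quat_k * quat_i = quat_j"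
  "quat_j * quat_i = - quat_k" "quat_k * quat_j = - quat_i" "quat_i * quat_k = - quat_j"
  by (simp_all add: quat_i_def quat_j_def quat_k_def quaternion_eq_iff quaternion_sel_times)


section \<open>Normalised Lebesgue measure and \<open>L\<^sup>p\<close> norms\<close>

definition mu :: "'a::euclidean_space measure" where
  "mu = density lebesgue (\<lambda>_. ennreal (1 / (2 * pi) powr (real DIM('a) / 2)))"

(* Power of an extended nonnegative real.  Meaningful for a > 0 only, the sole case used below:
   then 0 and infinity are mapped to themselves. *)
definition ennpowr :: "ennreal \<Rightarrow> real \<Rightarrow> ennreal" where
  "ennpowr x a = (if x = \<infinity> then \<infinity> else ennreal (enn2real x powr a))"

definition Lp_norm :: "real \<Rightarrow> ('a::euclidean_space \<Rightarrow> 'b::real_normed_vector) \<Rightarrow> ennreal" where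
  "Lp_norm p F = ennpowr (\<integral>\<^sup>+ x. ennreal (norm (F x) powr p) \<partial>mu) (1 / p)"

(* Functions rather than classes modulo null sets; f is required to be Lebesgue measurable. *)
definition in_L2 :: "('a::euclidean_space \<Rightarrow> quaternion) \<Rightarrow> bool" where
  "in_L2 f \<longleftrightarrow> f \<in> borel_measurable lebesgue \<and> Lp_norm 2 f < \<infinity>"

(* Non-zero as an element of L^2, i.e. not almost everywhere zero. *)
definition quaternion_window :: "('a::euclidean_space \<Rightarrow> quaternion) \<Rightarrow> bool" where
  "quaternion_window g \<longleftrightarrow> in_L2 g \<and> \<not> (AE t in lebesgue. g t = 0)"


section \<open>The radar quaternion ambiguity function\<close>

(* R^(2d) is (real^'d) x (real^'d) and d = CARD('d).  The product norm is the Euclidean one.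
   Quaternion multiplication is not commutative: the factors are in the order of the definition.
   For f, g in L^2 the integrand is integrable for every (x, w), by Cauchy-Schwarz. *)
definition ambiguity ::
  "((real^'d) \<times> (real^'d) \<Rightarrow> quaternion) \<Rightarrow> ((real^'d) \<times> (real^'d) \<Rightarrow> quaternion) \<Rightarrow>
   ((real^'d) \<times> (real^'d)) \<times> ((real^'d) \<times> (real^'d)) \<Rightarrow> quaternion" where
  "ambiguity f g = (\<lambda>(x, w).
     \<integral>t. exp (- ((fst t \<bullet> fst w) *\<^sub>R quat_i)) * f (t + x /\<^sub>R 2) * qcnj (g (t - x /\<^sub>R 2))
         * exp (- ((snd t \<bullet> snd w) *\<^sub>R quat_j)) \<partial>mu)"

definition M_const :: "real \<Rightarrow> real \<Rightarrow> real \<Rightarrow> real" where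
  "M_const d \<epsilon> p =
     ((2 * d + \<epsilon>) /
       (2 powr (\<epsilon> * (2 * d + 2 * p + 2) / ((2 * d + \<epsilon>) * (p + 1)))
        * \<epsilon> powr (2 * \<epsilon> / (2 * d + \<epsilon>))
        * Gamma (2 * d) powr (\<epsilon> / ((2 * d + \<epsilon>) * (p + 1)))
        * (2 * d - \<epsilon>) powr ((2 * d - \<epsilon>) / (2 * d + \<epsilon>) + \<epsilon> / ((2 * d + \<epsilon>) * (p + 1)))))
     powr (p * (p + 1))"

end

theory Submission
  imports Defs
begin

text \<open>
  By Cauchy--Schwarz, \<open>\<bar>A(f,g)\<bar>\<close> is bounded everywhere by \<open>N = \<parallel>f\<parallel> \<parallel>g\<parallel>\<close>; no other property of the
  ambiguity function enters. Put \<open>S = \<parallel>\<bar>z\<bar>\<^sup>\<epsilon> A\<parallel>\<close>. On the ball of radius \<open>r\<close>,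
  \<open>\<bar>A\<bar>\<^sup>p\<^sup>+\<^sup>1 \<le> N\<^sup>p \<bar>A\<bar>\<close>, and Cauchy--Schwarz against the weight \<open>\<bar>z\<bar>\<^sup>-\<^sup>\<epsilon>\<close> bounds the integral of \<open>\<bar>A\<bar>\<close>
  by a multiple of \<open>r\<^sup>2\<^sup>d\<^sup>-\<^sup>\<epsilon> S\<close>; outside it \<open>\<bar>A\<bar>\<^sup>p\<^sup>+\<^sup>1 \<le> N\<^sup>p\<^sup>-\<^sup>1 r\<^sup>-\<^sup>2\<^sup>\<epsilon> (\<bar>z\<bar>\<^sup>\<epsilon> \<bar>A\<bar>)\<^sup>2\<close>. Hoelder's inequality on
  \<open>\<Sigma>\<close> passes from the exponent \<open>p + 1\<close> to \<open>p\<close>, and the constant of the theorem comes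
  from minimising over \<open>r\<close> the sum of the \<open>(p + 1)\<close>-th roots of the two bounds.
\<close>

section \<open>Quaternion conjugation and exponentials of norm one\<close>

lemma bounded_linear_qcnj: "bounded_linear qcnj"
  by (subst linear_conv_bounded_linear [symmetric], intro linearI)
    (simp_all add: quaternion_eq_iff)

lemma borel_measurable_qcnj [measurable]: "qcnj \<in> borel_measurable borel"
  by (intro borel_measurable_continuous_onI linear_continuous_on bounded_linear_qcnj)

lemma norm_qcnj [simp]: "norm (qcnj x) = norm x"
  by (simp add: norm_quaternion_def)

text \<open>Conjugation is a continuous linear anti-automorphism, and reversing the order is
  harmless on powers of a single element. Applied termwise to the exponential series it gives
  \<open>qcnj (exp x) = exp (- x)\<close>, so the squared norm of \<open>exp x\<close> is
  \<open>exp x * exp (- x) = 1\<close>.\<close>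

lemma norm_exp_quaternion_imaginary:
  fixes x :: quaternion
  assumes "qcnj x = - x"
  shows "norm (exp x) = 1"
proof -
  have anti: "qcnj (a * b) = qcnj b * qcnj a" for a b
    by (simp add: quaternion_eq_iff quaternion_sel_times algebra_simps)
  have pow: "qcnj (x ^ n) = (- x) ^ n" for n
  proof (induction n)
    case 0
    show ?case by (simp add: quaternion_eq_iff)
  next
    case (Suc n)
    then show ?case by (simp only: power_Suc anti assms power_commutes)
  qed
  have "(\<lambda>n. qcnj (x ^ n /\<^sub>R fact n)) sums qcnj (exp x)"
    using bounded_linear.sums [OF bounded_linear_qcnj exp_converges] .
  moreover have "qcnj (x ^ n /\<^sub>R fact n) = (- x) ^ n /\<^sub>R fact n" for n
    using bounded_linear.linear [OF bounded_linear_qcnj] by (simp add: linear_scale pow)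
  ultimately have "qcnj (exp x) = exp (- x)"
    using exp_converges [of "- x"] by (metis (no_types, lifting) ext sums_unique2)
  then have "(norm (exp x))\<^sup>2 *\<^sub>R 1 = (1 :: quaternion)"
    using quaternion_mult_qcnj(1) [of "exp x"] by (simp add: exp_minus_inverse)
  then have "(norm (exp x))\<^sup>2 = 1"
    by (simp add: quaternion_eq_iff)
  then show ?thesis
    by (simp add: power2_eq_1_iff)
      (smt (verit) norm_ge_zero)
qed

lemma norm_exp_quat_units [simp]:
  "norm (exp (- (r *\<^sub>R quat_i))) = 1" "norm (exp (- (r *\<^sub>R quat_j))) = 1"
  by (intro norm_exp_quaternion_imaginary; simp add: quaternion_eq_iff quat_i_def quat_j_def)+

section \<open>The normalised measure, Borel representatives and translations\<close>

definition mu_scale :: "'a::euclidean_space itself \<Rightarrow> real" where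
  "mu_scale _ = 1 / (2 * pi) powr (real DIM('a) / 2)"

lemma mu_scale_pos: "mu_scale TYPE('a::euclidean_space) > 0"
  by (simp add: mu_scale_def)

lemma sets_mu [measurable_cong]: "sets mu = sets lebesgue"
  by (simp add: mu_def)

lemma nn_integral_mu:
  fixes F :: "'a::euclidean_space \<Rightarrow> ennreal"
  assumes "F \<in> borel_measurable lebesgue"
  shows "(\<integral>\<^sup>+x. F x \<partial>mu) = ennreal (mu_scale TYPE('a)) * (\<integral>\<^sup>+x. F x \<partial>lborel)"
  using assms unfolding mu_def mu_scale_def
  by (simp add: nn_integral_density nn_integral_cmult del: nn_integral_completion)
    (simp add: nn_integral_completion)

lemma AE_mu_iff:
  "(AE x in (mu :: 'a::euclidean_space measure). P x) \<longleftrightarrow> (AE x in lebesgue. P x)"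
  unfolding mu_def by (subst AE_density) simp_all

lemma integral_mu:
  fixes h :: "'a::euclidean_space \<Rightarrow> 'b::{banach, second_countable_topology}"
  assumes "h \<in> borel_measurable borel"
  shows "(\<integral>x. h x \<partial>mu) = mu_scale TYPE('a) *\<^sub>R (\<integral>x. h x \<partial>lborel)"
proof -
  have "h \<in> borel_measurable lebesgue"
    using assms by (intro measurable_completion) simp
  then show ?thesis
    using assms unfolding mu_def mu_scale_def
    by (simp add: integral_density integral_completion)
qed

text \<open>The real-valued case is applied to each coordinate and the coordinates are reassembled.
  A Borel representative composed with the shifts of \<open>t\<close> by
  \<open>x /\<^sub>R 2\<close> is jointly Borel in \<open>x\<close> and \<open>t\<close>, which is
  what makes the integral over \<open>t\<close> measurable in its parameters.\<close>

lemma lebesgue_ex_borel: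
  fixes f :: "'a::euclidean_space \<Rightarrow> 'b::euclidean_space"
  assumes "f \<in> borel_measurable lebesgue"
  obtains f' where "f' \<in> borel_measurable borel" "AE x in lborel. f x = f' x"
proof -
  have "\<exists>h. h \<in> borel_measurable borel \<and> (AE x in lborel. f x \<bullet> b = h x)" for b
    using completion_ex_borel_measurable_real [of "\<lambda>x. f x \<bullet> b" lborel] assms by auto
  then obtain h where h: "\<And>b. h b \<in> borel_measurable borel"
      "\<And>b. AE x in lborel. f x \<bullet> b = h b x"
    by metis
  define f' where "f' = (\<lambda>x. \<Sum>b\<in>Basis. h b x *\<^sub>R b)"
  show thesis
  proof
    show "f' \<in> borel_measurable borel"
      unfolding f'_def using h(1) by measurable
    have "AE x in lborel. \<forall>b\<in>Basis. f x \<bullet> b = h b x"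
      using h(2) by (intro AE_finite_allI) auto
    then show "AE x in lborel. f x = f' x"
    proof eventually_elim
      case (elim x)
      then have "f' x = (\<Sum>b\<in>Basis. (f x \<bullet> b) *\<^sub>R b)"
        by (simp add: f'_def)
      then show ?case
        by (simp add: euclidean_representation)
    qed
  qed
qed

lemma AE_lborel_translate:
  fixes v :: "'a::euclidean_space"
  assumes "AE x in lborel. P x"
  shows "AE x in lborel. P (x + v)"
proof -
  have "AE x in distr lborel borel ((+) v). P x"
    unfolding lborel_distr_plus by (rule assms)
  then have "AE x in lborel. P (v + x)"
    by (rule AE_distrD [rotated]) simp
  then show ?thesis
    by (simp add: add.commute)
qed

lemma nn_integral_lborel_translate:
  fixes v :: "'a::euclidean_space"
  assumes [measurable]: "F \<in> borel_measurable borel"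
  shows "(\<integral>\<^sup>+x. F (x + v) \<partial>lborel) = (\<integral>\<^sup>+x. F x \<partial>lborel)"
proof -
  have "(\<integral>\<^sup>+x. F x \<partial>distr lborel borel ((+) v)) = (\<integral>\<^sup>+x. F (v + x) \<partial>lborel)"
    by (rule nn_integral_distr) simp_all
  then show ?thesis
    by (simp add: lborel_distr_plus add.commute)
qed

text \<open>This is completeness of Lebesgue measure: the preimages of a Borel set under
  \<open>f\<close> and \<open>f'\<close> differ only inside a null set.\<close>

lemma measurable_lebesgue_AE_eq:
  fixes f :: "'a::euclidean_space \<Rightarrow> 'b::topological_space"
  assumes f': "f' \<in> borel_measurable borel" and eq: "AE x in lborel. f x = f' x"
  shows "f \<in> borel_measurable lebesgue"
proof (rule measurableI)
  fix A :: "'b set" assume A: "A \<in> sets borel"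
  show "f -` A \<inter> space lebesgue \<in> sets lebesgue"
  proof (rule completion.in_sets_AE)
    show "f' -` A \<inter> space lebesgue \<in> sets lebesgue"
      using measurable_sets [OF measurable_completion, of f' lborel borel A] f' A by simp
    show "AE x in lebesgue. x \<in> f' -` A \<inter> space lebesgue \<longleftrightarrow> x \<in> f -` A \<inter> space lebesgue"
      using AE_completion [OF eq] by eventually_elim auto
  qed auto
qed auto

text \<open>Cauchy-Schwarz for nonnegative integrals bounds a square. This extracts the root even
  when the integral is not yet known to be finite.\<close>

lemma ennreal_le_of_power2_le:
  assumes "x\<^sup>2 \<le> ennreal (v\<^sup>2)" "0 \<le> v"
  shows "x \<le> ennreal v"
proof (cases x)
  case (real y)
  then have "y\<^sup>2 \<le> v\<^sup>2"
    using assms by (simp add: ennreal_power)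
  then show ?thesis
    using real assms by (auto intro!: ennreal_leI power2_le_imp_le)
next
  case top
  then show ?thesis
    using assms by (simp add: top_unique)
qed

text \<open>Serves to turn a zero or finite weighted norm in the final case analysis into the value
  of an integral.\<close>

lemma Lp_norm_eq_ennreal_iff:
  assumes "0 < p" "0 \<le> s"
  shows "Lp_norm p F = ennreal s \<longleftrightarrow> (\<integral>\<^sup>+x. ennreal (norm (F x) powr p) \<partial>mu) = ennreal (s powr p)"
proof (cases "\<integral>\<^sup>+x. ennreal (norm (F x) powr p) \<partial>mu")
  case (real y)
  have "y powr (1 / p) = s \<longleftrightarrow> y = s powr p"
    using assms real by (auto simp: powr_powr)
  then show ?thesis
    using real assms by (simp add: Lp_norm_def ennpowr_def)
next
  case top
  then show ?thesis
    by (simp add: Lp_norm_def ennpowr_def)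
qed

section \<open>The integral of a negative power of the norm over a ball\<close>

lemma nn_integral_cball_norm_powr:
  fixes r s :: real
  assumes s: "0 < s" "s < DIM('a::euclidean_space)" and r: "0 < r"
  shows "(\<integral>\<^sup>+x. indicator (cball (0::'a) r) x * ennreal (norm x powr (- s)) \<partial>lborel)
    = ennreal (unit_ball_vol DIM('a) * DIM('a) / (DIM('a) - s) * r powr (DIM('a) - s))"
proof -
  have [measurable]: "cball (0::'a) u \<in> sets borel" for u
    by simp
  define n where "n = real DIM('a)"
  define V where "V = unit_ball_vol n"
  have V: "V \<ge> 0"
    unfolding V_def n_def by simp
  have vol: "emeasure lborel (cball (0::'a) u) = ennreal (V * u powr n)" if "0 < u" for u
    using that by (simp add: emeasure_cball V_def n_def powr_realpow)
  text \<open>For \<open>0 < \<bar>x\<bar> \<le> r\<close> write \<open>\<bar>x\<bar>\<^sup>-\<^sup>s\<close> as \<open>r\<^sup>-\<^sup>s\<close> plus the integral of \<open>s u\<^sup>-\<^sup>s\<^sup>-\<^sup>1\<close> over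
    \<open>\<bar>x\<bar> \<le> u \<le> r\<close>; exchanging the integrals leaves only volumes of balls.\<close>
  define k where "k = (\<lambda>x u. indicator {0<..r} u * (indicator (cball (0::'a) u) x * ennreal (s * u powr (- s - 1))))"
  have layer: "indicator (cball 0 r) x * ennreal (norm x powr (- s))
      = indicator (cball 0 r) x * ennreal (r powr (- s)) + (\<integral>\<^sup>+u. k x u \<partial>lborel)"
    if "x \<noteq> 0" for x
  proof (cases "norm x \<le> r")
    case True
    have "k x u = ennreal (s * u powr (- s - 1)) * indicator {norm x..r} u" for u
      using that s by (auto simp: k_def indicator_def) (meson less_le_trans zero_less_norm_iff)
    then have "(\<integral>\<^sup>+u. k x u \<partial>lborel)
        = (\<integral>\<^sup>+u. ennreal (s * u powr (- s - 1)) * indicator {norm x..r} u \<partial>lborel)"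
      by simp
    also have "\<dots> = ennreal (- (r powr (- s)) - (- (norm x powr (- s))))"
      using that s True
      by (intro nn_integral_FTC_Icc) (auto intro!: derivative_eq_intros
          intro: less_le_trans [of 0 "norm x"] simp: has_real_derivative_iff_has_vector_derivative [symmetric])
    finally have "(\<integral>\<^sup>+u. k x u \<partial>lborel) = ennreal (norm x powr (- s) - r powr (- s))"
      by simp
    moreover have "r powr (- s) \<le> norm x powr (- s)"
      using that s True by (intro powr_mono2') auto
    ultimately show ?thesis
      using True by (simp flip: ennreal_plus)
  next
    case False
    then have "k x u = 0" for u
      by (auto simp: k_def indicator_def)
    then show ?thesis
      using False by simp
  qed
  have split: "(\<integral>\<^sup>+x. indicator (cball (0::'a) r) x * ennreal (norm x powr (- s)) \<partial>lborel)
      = (\<integral>\<^sup>+x. indicator (cball (0::'a) r) x * ennreal (r powr (- s)) + (\<integral>\<^sup>+u. k x u \<partial>lborel) \<partial>lborel)"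
  proof (rule nn_integral_cong_AE)
    \<comment> \<open>At the origin the formula of \<open>layer\<close> fails:
      \<open>0 powr (- s)\<close> is 0 by convention, while the integral over \<open>u\<close>
      diverges. A single point is null.\<close>
    have "AE x in lborel. x \<noteq> (0::'a)"
      by (rule AE_lborel_singleton)
    then show "AE x in lborel. indicator (cball 0 r) x * ennreal (norm x powr (- s))
        = indicator (cball 0 r) (x::'a) * ennreal (r powr (- s)) + (\<integral>\<^sup>+u. k x u \<partial>lborel)"
      by eventually_elim (rule layer)
  qed
  have meas [measurable]: "case_prod k \<in> borel_measurable (lborel \<Otimes>\<^sub>M lborel)"
  proof -
    have "case_prod k = (\<lambda>z. indicator {0<..r} (snd z) *
        (indicator {z. norm (fst z) \<le> snd z} z * ennreal (s * snd z powr (- s - 1))))"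
      by (auto simp: k_def fun_eq_iff indicator_def)
    also have "\<dots> \<in> borel_measurable (lborel \<Otimes>\<^sub>M lborel)"
      by measurable
    finally show ?thesis .
  qed
  have "(\<integral>\<^sup>+x. \<integral>\<^sup>+u. k x u \<partial>lborel \<partial>lborel) = (\<integral>\<^sup>+u. \<integral>\<^sup>+x. k x u \<partial>lborel \<partial>lborel)"
    using lborel_pair.Fubini' [OF meas] by simp
  also have "\<dots> = (\<integral>\<^sup>+u. indicator {0..r} u * ennreal (s * V * u powr (n - s - 1)) \<partial>lborel)"
  proof (rule nn_integral_cong)
    fix u :: real
    have "(\<integral>\<^sup>+x. k x u \<partial>lborel)
        = indicator {0<..r} u * (emeasure lborel (cball (0::'a) u) * ennreal (s * u powr (- s - 1)))"
      unfolding k_def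
      by (subst nn_integral_cmult, simp, subst nn_integral_multc, simp_all)
    also have "\<dots> = indicator {0..r} u * ennreal (s * V * u powr (n - s - 1))"
    proof (cases "0 < u \<and> u \<le> r")
      case True
      have "u powr (n - s - 1) = u powr n * u powr (- s - 1)"
        by (simp add: algebra_simps flip: powr_add)
      then show ?thesis
        using True V s by (simp add: vol ac_simps flip: ennreal_mult)
    next
      case False
      then show ?thesis
        by (auto simp: indicator_def)
    qed
    finally show "(\<integral>\<^sup>+x. k x u \<partial>lborel) = indicator {0..r} u * ennreal (s * V * u powr (n - s - 1))" .
  qed
  also have "\<dots> = ennreal (s * V * (r powr (n - s) / (n - s)))"
  proof -
    \<comment> \<open>The exponent exceeds -1 because \<open>s < n\<close>, so the power is
      integrable down to 0.\<close>
    have "((\<lambda>u. s * V * u powr (n - s - 1)) has_integral s * V * (r powr (n - s) / (n - s))) {0..r}"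
      using has_integral_mult_right [OF has_integral_powr_from_0 [of "n - s - 1" r], of "s * V"] s r
      by (simp add: n_def)
    from nn_integral_has_integral_lebesgue [OF _ this] show ?thesis
      using s V by (simp add: ennreal_mult' ennreal_indicator)
  qed
  finally have k_int: "(\<integral>\<^sup>+x. \<integral>\<^sup>+u. k x u \<partial>lborel \<partial>lborel) = ennreal (s * V * (r powr (n - s) / (n - s)))" .
  have "(\<integral>\<^sup>+x. indicator (cball 0 r) x * ennreal (r powr (- s)) \<partial>(lborel :: 'a measure))
      = ennreal (V * r powr n * r powr (- s))"
    using r V by (subst nn_integral_multc) (simp_all add: vol ennreal_mult)
  also have "V * r powr n * r powr (- s) = V * r powr (n - s)"
    by (simp add: powr_diff powr_minus_divide)
  finally have c_int: "(\<integral>\<^sup>+x. indicator (cball 0 r) x * ennreal (r powr (- s)) \<partial>(lborel :: 'a measure))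
      = ennreal (V * r powr (n - s))" .
  have "n - s > 0"
    using s by (simp add: n_def)
  have "(\<integral>\<^sup>+x. indicator (cball (0::'a) r) x * ennreal (norm x powr (- s)) \<partial>lborel)
      = ennreal (V * r powr (n - s)) + ennreal (s * V * (r powr (n - s) / (n - s)))"
    unfolding split by (subst nn_integral_add) (simp_all add: k_int c_int)
  also have "\<dots> = ennreal (V * r powr (n - s) + s * V * (r powr (n - s) / (n - s)))"
    using V s \<open>n - s > 0\<close> by (intro ennreal_plus [symmetric]) auto
  \<comment> \<open>The two terms combine through 1 + s/(n - s) = n/(n - s).\<close>
  also have "V * r powr (n - s) + s * V * (r powr (n - s) / (n - s)) = V * n / (n - s) * r powr (n - s)"
    using \<open>n - s > 0\<close> by (simp add: field_simps)
  finally show ?thesis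
    by (simp add: V_def n_def)
qed

section \<open>Measurability and uniform bound of the ambiguity function\<close>

lemma Lp_norm_2_power2: "(Lp_norm 2 F)\<^sup>2 = (\<integral>\<^sup>+x. (ennreal (norm (F x)))\<^sup>2 \<partial>mu)"
proof -
  have "(ennpowr x (1 / 2))\<^sup>2 = x" for x
    by (cases x) (auto simp: ennpowr_def ennreal_power powr_half_sqrt)
  then show ?thesis
    by (simp add: Lp_norm_def ennreal_power)
qed

lemma Lp_norm_2_cong_AE:
  assumes "AE x in lborel. F x = G x"
  shows "Lp_norm 2 F = Lp_norm 2 G"
proof -
  have "AE x in mu. F x = G x"
    unfolding AE_mu_iff using assms by (rule AE_completion)
  then have "(\<integral>\<^sup>+x. ennreal (norm (F x) powr 2) \<partial>mu) = (\<integral>\<^sup>+x. ennreal (norm (G x) powr 2) \<partial>mu)"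
    by (auto intro!: nn_integral_cong_AE elim!: eventually_mono)
  then show ?thesis
    unfolding Lp_norm_def by simp
qed

context
  fixes f g :: "(real^'d) \<times> (real^'d) \<Rightarrow> quaternion"
  assumes f: "f \<in> borel_measurable borel" and g: "g \<in> borel_measurable borel"
begin

lemma borel_measurable_ambiguity_integrand:
  "(\<lambda>((x, w), t). exp (- ((fst t \<bullet> fst w) *\<^sub>R quat_i)) * f (t + x /\<^sub>R 2) * qcnj (g (t - x /\<^sub>R 2))
      * exp (- ((snd t \<bullet> snd w) *\<^sub>R quat_j))) \<in> borel_measurable borel"
proof -
  note [measurable] = f g
  have [measurable]: "(\<lambda>r. exp (- (r *\<^sub>R q))) \<in> borel_measurable borel" for q :: quaternion
  proof (rule borel_measurable_continuous_onI)
    have "continuous_on UNIV (\<lambda>r. exp (r *\<^sub>R (- q)))"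
      by (rule continuous_on_vector_derivative) (rule exp_scaleR_has_vector_derivative_right)
    then show "continuous_on UNIV (\<lambda>r. exp (- (r *\<^sub>R q)))"
      by simp
  qed
  have [measurable]: "fst \<in> borel \<rightarrow>\<^sub>M borel" "snd \<in> borel \<rightarrow>\<^sub>M borel"
    by (intro borel_measurable_continuous_onI continuous_intros)+
  show ?thesis
    unfolding case_prod_beta' by measurable
qed

lemma borel_measurable_ambiguity_borel: "ambiguity f g \<in> borel_measurable borel"
proof -
  define h where "h = (\<lambda>(z :: ((real^'d) \<times> (real^'d)) \<times> ((real^'d) \<times> (real^'d))) t.
      exp (- ((fst t \<bullet> fst (snd z)) *\<^sub>R quat_i)) * f (t + fst z /\<^sub>R 2) * qcnj (g (t - fst z /\<^sub>R 2))
      * exp (- ((snd t \<bullet> snd (snd z)) *\<^sub>R quat_j)))"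
  have h: "case_prod h \<in> borel_measurable (borel \<Otimes>\<^sub>M lborel)"
  proof -
    have "case_prod h \<in> borel_measurable borel"
      using borel_measurable_ambiguity_integrand by (simp add: h_def case_prod_beta')
    then show ?thesis
      by (simp add: borel_prod flip: borel_prod cong: measurable_cong_sets)
  qed
  have "h z \<in> borel_measurable borel" for z
    using measurable_compose [OF measurable_Pair1' [of z borel lborel] h] by simp
  then have "ambiguity f g = (\<lambda>z. mu_scale TYPE((real^'d) \<times> (real^'d)) *\<^sub>R (\<integral>t. h z t \<partial>lborel))"
    by (auto simp: ambiguity_def fun_eq_iff h_def case_prod_beta' simp flip: integral_mu)
  also have "\<dots> \<in> borel_measurable borel"
    using h by measurable
  finally show ?thesis .
qed

lemma norm_ambiguity_le_borel: "ennreal (norm (ambiguity f g z)) \<le> Lp_norm 2 f * Lp_norm 2 g"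
proof -
  obtain x w where z: "z = (x, w)" by (cases z)
  define c where "c = mu_scale TYPE((real^'d) \<times> (real^'d))"
  define h where "h = (\<lambda>t. exp (- ((fst t \<bullet> fst w) *\<^sub>R quat_i)) * f (t + x /\<^sub>R 2) * qcnj (g (t - x /\<^sub>R 2))
      * exp (- ((snd t \<bullet> snd w) *\<^sub>R quat_j)))"
  have A: "ambiguity f g z = (\<integral>t. h t \<partial>mu)"
    by (simp add: ambiguity_def z h_def)
  note [measurable] = f g
  have lb: "F \<in> borel_measurable lebesgue" if "F \<in> borel_measurable borel"
    for F :: "(real^'d) \<times> (real^'d) \<Rightarrow> ennreal"
    using that by (intro measurable_completion) simp
  have L2: "(Lp_norm 2 F)\<^sup>2 = ennreal c * (\<integral>\<^sup>+t. (ennreal (norm (F (t + v))))\<^sup>2 \<partial>lborel)"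
    if [measurable]: "F \<in> borel_measurable borel" for F :: "(real^'d) \<times> (real^'d) \<Rightarrow> quaternion" and v
  proof -
    have "(Lp_norm 2 F)\<^sup>2 = ennreal c * (\<integral>\<^sup>+t. (ennreal (norm (F t)))\<^sup>2 \<partial>lborel)"
      unfolding c_def Lp_norm_2_power2 by (intro nn_integral_mu lb) measurable
    then show ?thesis
      by (subst nn_integral_lborel_translate [where F = "\<lambda>t. (ennreal (norm (F t)))\<^sup>2"]) simp_all
  qed
  have "ennreal (norm (ambiguity f g z)) \<le> (\<integral>\<^sup>+t. ennreal (norm (h t)) \<partial>mu)"
    unfolding A
    \<comment> \<open>If \<open>h\<close> is not integrable, its Bochner integral is 0 by default
      and the bound is trivial.\<close>
    by (cases "integrable mu h") (auto intro: integral_norm_bound_ennreal simp: not_integrable_integral_eq)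
  also have "\<dots> = (\<integral>\<^sup>+t. ennreal (norm (f (t + x /\<^sub>R 2))) * ennreal (norm (g (t + - (x /\<^sub>R 2)))) \<partial>mu)"
    by (simp add: h_def norm_mult ennreal_mult)
  also have "\<dots> = ennreal c * (\<integral>\<^sup>+t. ennreal (norm (f (t + x /\<^sub>R 2))) * ennreal (norm (g (t + - (x /\<^sub>R 2)))) \<partial>lborel)"
    unfolding c_def by (intro nn_integral_mu lb) measurable
  finally have "(ennreal (norm (ambiguity f g z)))\<^sup>2
      \<le> (ennreal c * (\<integral>\<^sup>+t. ennreal (norm (f (t + x /\<^sub>R 2))) * ennreal (norm (g (t + - (x /\<^sub>R 2)))) \<partial>lborel))\<^sup>2"
    by (intro power_mono) auto
  also have "\<dots> \<le> (ennreal c)\<^sup>2 * ((\<integral>\<^sup>+t. (ennreal (norm (f (t + x /\<^sub>R 2))))\<^sup>2 \<partial>lborel)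
      * (\<integral>\<^sup>+t. (ennreal (norm (g (t + - (x /\<^sub>R 2)))))\<^sup>2 \<partial>lborel))"
    unfolding power_mult_distrib by (intro mult_left_mono Cauchy_Schwarz_nn_integral) simp_all
  also have "\<dots> = (Lp_norm 2 f * Lp_norm 2 g)\<^sup>2"
    unfolding power_mult_distrib L2 [OF f, of "x /\<^sub>R 2"] L2 [OF g, of "- (x /\<^sub>R 2)"]
    by (simp add: power2_eq_square ac_simps)
  finally have "(ennreal (norm (ambiguity f g z)))\<^sup>2 \<le> (Lp_norm 2 f * Lp_norm 2 g)\<^sup>2" .
  then show ?thesis
  proof (cases "Lp_norm 2 f * Lp_norm 2 g")
    case (real v)
    then show ?thesis
      using \<open>(ennreal (norm (ambiguity f g z)))\<^sup>2 \<le> (Lp_norm 2 f * Lp_norm 2 g)\<^sup>2\<close>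
      by (auto simp: ennreal_power intro!: ennreal_le_of_power2_le)
  qed simp
qed

end

text \<open>For each fixed \<open>z\<close> the exceptional sets are merely translated and stay
  null, so the two integrals agree at every point and not just almost everywhere.\<close>

lemma ambiguity_cong_AE:
  fixes f g :: "(real^'d) \<times> (real^'d) \<Rightarrow> quaternion"
  assumes f': "f' \<in> borel_measurable borel" "AE t in lborel. f t = f' t"
    and g': "g' \<in> borel_measurable borel" "AE t in lborel. g t = g' t"
  shows "ambiguity f g = ambiguity f' g'"
proof (rule ext)
  fix z :: "((real^'d) \<times> (real^'d)) \<times> ((real^'d) \<times> (real^'d))"
  obtain x w where z: "z = (x, w)" by (cases z)
  define h where "h = (\<lambda>f g (t :: (real^'d) \<times> (real^'d)). exp (- ((fst t \<bullet> fst w) *\<^sub>R quat_i)) * f (t + x /\<^sub>R 2) * qcnj (g (t - x /\<^sub>R 2))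
      * exp (- ((snd t \<bullet> snd w) *\<^sub>R quat_j)))"
  have A: "ambiguity f g z = (\<integral>t. h f g t \<partial>mu)" for f g
    by (simp add: ambiguity_def z h_def)
  have "AE t in lborel. f (t + x /\<^sub>R 2) = f' (t + x /\<^sub>R 2)" "AE t in lborel. g (t + - (x /\<^sub>R 2)) = g' (t + - (x /\<^sub>R 2))"
    by (rule AE_lborel_translate [OF f'(2)], rule AE_lborel_translate [OF g'(2)])
  then have eq: "AE t in lborel. h f g t = h f' g' t"
    by eventually_elim (simp add: h_def)
  have "h f' g' \<in> borel_measurable borel"
    using measurable_compose [OF measurable_Pair1' [of "(x, w)" borel borel],
        of "\<lambda>((x, w), t). exp (- ((fst t \<bullet> fst w) *\<^sub>R quat_i)) * f' (t + x /\<^sub>R 2) * qcnj (g' (t - x /\<^sub>R 2))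
          * exp (- ((snd t \<bullet> snd w) *\<^sub>R quat_j))" borel]
      borel_measurable_ambiguity_integrand [OF f'(1) g'(1)]
    by (simp add: h_def borel_prod)
  then have "h f g \<in> borel_measurable lebesgue" "h f' g' \<in> borel_measurable lebesgue"
    using eq by (auto intro: measurable_lebesgue_AE_eq)
  then show "ambiguity f g z = ambiguity f' g' z"
    unfolding A using AE_completion [OF eq]
    by (intro integral_cong_AE) (simp_all add: AE_mu_iff cong: measurable_cong_sets [OF sets_mu refl])
qed

text \<open>Passing to Borel representatives changes neither the two norms nor any value of the
  ambiguity function, so both claims reduce to the Borel case.\<close>

lemma
  fixes f g :: "(real^'d) \<times> (real^'d) \<Rightarrow> quaternion"
  assumes f: "f \<in> borel_measurable lebesgue" and g: "g \<in> borel_measurable lebesgue"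
  shows borel_measurable_ambiguity: "ambiguity f g \<in> borel_measurable borel"
    and norm_ambiguity_le: "ennreal (norm (ambiguity f g z)) \<le> Lp_norm 2 f * Lp_norm 2 g"
proof -
  obtain f' where f': "f' \<in> borel_measurable borel" "AE t in lborel. f t = f' t"
    using lebesgue_ex_borel [OF f] .
  obtain g' where g': "g' \<in> borel_measurable borel" "AE t in lborel. g t = g' t"
    using lebesgue_ex_borel [OF g] .
  note eq = ambiguity_cong_AE [OF f' g'] Lp_norm_2_cong_AE [OF f'(2)] Lp_norm_2_cong_AE [OF g'(2)]
  show "ambiguity f g \<in> borel_measurable borel"
    unfolding eq using f'(1) g'(1) by (rule borel_measurable_ambiguity_borel)
  show "ennreal (norm (ambiguity f g z)) \<le> Lp_norm 2 f * Lp_norm 2 g"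
    unfolding eq using f'(1) g'(1) by (rule norm_ambiguity_le_borel)
qed

section \<open>Real inequalities and the optimal radius\<close>

lemma powr_add_le_add_powr:
  fixes x y s :: real
  assumes "0 < x" "0 < y" "1 \<le> s"
  shows "x powr s + y powr s \<le> (x + y) powr s"
proof -
  \<comment> \<open>One factor of \<open>u\<close> is kept and the remaining power
    \<open>s - 1\<close>, which is nonnegative, is enlarged to that of \<open>x + y\<close>. Adding
    the cases \<open>u = x\<close> and \<open>u = y\<close> gives superadditivity.\<close>
  have le: "u powr s \<le> u * (x + y) powr (s - 1)" if "0 < u" "u \<le> x + y" for u
  proof -
    have "u powr s = u * u powr (s - 1)"
      using that by (simp add: powr_mult_base)
    also have "\<dots> \<le> u * (x + y) powr (s - 1)"
      using that assms by (intro mult_left_mono powr_mono2) auto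
    finally show ?thesis .
  qed
  have "x powr s + y powr s \<le> x * (x + y) powr (s - 1) + y * (x + y) powr (s - 1)"
    using assms by (intro add_mono le) auto
  also have "\<dots> = (x + y) powr s"
    using assms powr_mult_base [of "x + y" "s - 1"] by (simp add: distrib_right)
  finally show ?thesis .
qed

text \<open>This is the equality case of the weighted arithmetic-geometric mean inequality. The
  hypothesis says that x and y are in the ratio \<theta> to 1 - \<theta>, so x / \<theta> and y / (1
  - \<theta>) both equal x + y.\<close>

lemma ln_add_eq_weighted_ln:
  fixes x y \<theta> :: real
  assumes "0 < x" "0 < y" "0 < \<theta>" "\<theta> < 1" and eq: "ln (1 - \<theta>) + ln x = ln \<theta> + ln y"
  shows "ln (x + y) = \<theta> * (ln x - ln \<theta>) + (1 - \<theta>) * (ln y - ln (1 - \<theta>))"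
proof -
  have "ln ((1 - \<theta>) * x) = ln (\<theta> * y)"
    using assms by (simp add: ln_mult)
  then have "(1 - \<theta>) * x = \<theta> * y"
    using assms by (subst (asm) ln_inj_iff) auto
  then have "x + y = x / \<theta>"
    using assms by (simp add: field_simps)
  then have "ln (x + y) = ln x - ln \<theta>"
    using assms by (simp add: ln_div)
  moreover have "ln y - ln (1 - \<theta>) = ln x - ln \<theta>"
    using eq by simp
  ultimately show ?thesis
    by (simp only:) (simp flip: distrib_right)
qed

text \<open>The \<open>mu\<close>-integral of |z| to the power -2 \<epsilon> over the unit ball in
  dimension 4d.\<close>

definition ball_const :: "real \<Rightarrow> real \<Rightarrow> real" where
  "ball_const d \<epsilon> = 2 powr (- (2 * d)) / (Gamma (2 * d) * (2 * d - \<epsilon>))"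

lemma ball_const_pos: "0 < d \<Longrightarrow> \<epsilon> < 2 * d \<Longrightarrow> 0 < ball_const d \<epsilon>"
  by (simp add: ball_const_def)

text \<open>The unit ball in dimension 4d has volume pi^(2d) / Gamma(2d + 1). The powers of pi
  cancel against the density (2 pi)^(-2d), leaving 2^(-2d), and the factor 2d of Gamma(2d + 1)
  cancels against the dimension.\<close>

lemma nn_integral_mu_cball_norm_powr:
  fixes r \<epsilon> d :: real
  assumes d: "real DIM('a::euclidean_space) = 4 * d" and \<epsilon>: "0 < \<epsilon>" "\<epsilon> < 2 * d" and r: "0 < r"
  shows "(\<integral>\<^sup>+x. indicator (cball (0::'a) r) x * ennreal (norm x powr (- (2 * \<epsilon>))) \<partial>mu)
    = ennreal (ball_const d \<epsilon> * r powr (4 * d - 2 * \<epsilon>))"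
proof -
  have [simp]: "d > 0"
  proof -
    have "0 < real DIM('a)"
      by simp
    then show ?thesis
      unfolding d by simp
  qed
  have "Gamma (2 * d + 1) = 2 * d * Gamma (2 * d)"
    using nonpos_Ints_nonpos [of "2 * d"] \<open>d > 0\<close> by (intro Gamma_plus1) auto
  moreover define w where "w = 2 * d - \<epsilon>"
  then have w: "0 < w" "4 * d - 2 * \<epsilon> = 2 * w"
    using \<epsilon> by simp_all
  ultimately have const: "mu_scale TYPE('a) * (unit_ball_vol (4 * d) * (4 * d) / (4 * d - 2 * \<epsilon>) * r powr (4 * d - 2 * \<epsilon>))
      = ball_const d \<epsilon> * r powr (4 * d - 2 * \<epsilon>)"
    unfolding w ball_const_def w_def [symmetric]
    by (simp add: mu_scale_def d unit_ball_vol_def powr_mult powr_minus field_simps)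
  have [measurable]: "cball (0::'a) r \<in> sets borel"
    by simp
  have "(\<lambda>x. indicator (cball (0::'a) r) x * ennreal (norm x powr (- (2 * \<epsilon>)))) \<in> borel_measurable borel"
    by measurable
  then have "(\<lambda>x. indicator (cball (0::'a) r) x * ennreal (norm x powr (- (2 * \<epsilon>)))) \<in> borel_measurable lebesgue"
    by (intro measurable_completion) simp
  then show ?thesis
    using nn_integral_cball_norm_powr [where 'a = 'a, of "2 * \<epsilon>" r] assms const
    by (simp add: nn_integral_mu mu_scale_pos less_imp_le flip: ennreal_mult')
qed

text \<open>The square root is the L^2 norm of the weight |z| to the power -\<epsilon> on the ball
  of radius \<open>r\<close>.\<close>

definition inner_bound :: "real \<Rightarrow> real \<Rightarrow> real \<Rightarrow> real \<Rightarrow> real \<Rightarrow> real \<Rightarrow> real" where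
  "inner_bound d \<epsilon> p N S r = N powr p * (sqrt (ball_const d \<epsilon> * r powr (4 * d - 2 * \<epsilon>)) * S)"

definition outer_bound :: "real \<Rightarrow> real \<Rightarrow> real \<Rightarrow> real \<Rightarrow> real \<Rightarrow> real" where
  "outer_bound \<epsilon> p N S r = N powr (p - 1) * r powr (- (2 * \<epsilon>)) * S\<^sup>2"

text \<open>With x and y the (p + 1)-th roots of the inner and outer bound, the radius is the
  stationary point of x + y. Taking logarithms turns the evaluation at this radius into a linear
  identity.\<close>

lemma ex_optimal_radius:
  fixes d \<epsilon> p N S :: real
  assumes \<epsilon>: "0 < \<epsilon>" "\<epsilon> < 2 * d" and p: "1 \<le> p" and pos: "0 < N" "0 < S"
  obtains r where "0 < r"
    "(inner_bound d \<epsilon> p N S r + outer_bound \<epsilon> p N S r) powr p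
      \<le> M_const d \<epsilon> p * S powr (4 * p * d / (2 * d + \<epsilon>)) * N powr (p * (p - (2 * d - \<epsilon>) / (2 * d + \<epsilon>)))"
proof -
  define D where "D = 2 * d + \<epsilon>"
  define P where "P = p + 1"
  \<comment> \<open>As functions of r, x and y are proportional to the powers (2d - \<epsilon>)/P
    and -2 \<epsilon>/P. The derivative of x + y vanishes when (2d - \<epsilon>) x = 2 \<epsilon> y,
    that is, when x makes up the share \<theta> of x + y.\<close>
  define \<theta> where "\<theta> = 2 * \<epsilon> / D"
  define G where "G = ln (Gamma (2 * d))"
  define C where "C = ball_const d \<epsilon>"
  \<comment> \<open>The difference \<open>ln X - ln Y\<close> is affine in \<rho> = ln r with slope
    \<open>D\<close>. This \<rho> makes it equal to
    \<open>P * (ln \<theta> - ln (1 - \<theta>))\<close>, which is the required ratio of x to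
    y.\<close>
  define \<rho> where "\<rho> = (P * (ln \<theta> - ln (1 - \<theta>)) - ln N - ln C / 2 + ln S) / D"
  define r where "r = exp \<rho>"
  define X where "X = inner_bound d \<epsilon> p N S r"
  define Y where "Y = outer_bound \<epsilon> p N S r"
  have nz: "0 < D" "0 < P" "0 < d" "0 < Gamma (2 * d)" "0 < 2 * d - \<epsilon>" "0 < C" "0 < r"
    using \<epsilon> p by (auto simp: D_def P_def C_def r_def intro: ball_const_pos)
  have "Gamma (2 * d) \<noteq> 0"
    using nz(4) by linarith
  then have Gamma_nz: "(Gamma (2 * d) = 0) = False"
    by blast
  have d: "d = (D - \<epsilon>) / 2" and p': "p = P - 1"
    by (simp_all add: D_def P_def)
  have \<theta>: "0 < \<theta>" "\<theta> < 1" "1 - \<theta> = (2 * d - \<epsilon>) / D"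
    using nz \<epsilon> by (auto simp: \<theta>_def D_def field_simps)
  have XY: "0 < X" "0 < Y"
    using pos nz by (simp_all add: X_def Y_def inner_bound_def outer_bound_def C_def [symmetric])
  have lX: "ln X = p * ln N + (ln C + (4 * d - 2 * \<epsilon>) * \<rho>) / 2 + ln S"
    using pos nz by (simp add: X_def inner_bound_def C_def [symmetric] ln_mult ln_sqrt r_def)
  have lY: "ln Y = (p - 1) * ln N - 2 * \<epsilon> * \<rho> + 2 * ln S"
    using pos nz by (simp add: Y_def outer_bound_def ln_mult ln_realpow r_def)
  have l\<theta>: "ln \<theta> = ln 2 + ln \<epsilon> - ln D" "ln (1 - \<theta>) = ln (2 * d - \<epsilon>) - ln D"
    using nz \<epsilon> unfolding \<theta>(3) by (simp_all add: \<theta>_def ln_div ln_mult)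
  have lC: "ln C = - (2 * d * ln 2) - G - ln (2 * d - \<epsilon>)"
  proof -
    have "ln (c / (\<gamma> * a)) = ln c - ln \<gamma> - ln a" if "0 < c" "0 < \<gamma>" "0 < a" for a c \<gamma> :: real
      using that by (simp add: ln_div ln_mult)
    from this [of "2 powr - (2 * d)" "Gamma (2 * d)" "2 * d - \<epsilon>"] show ?thesis
      using nz(4,5) by (simp add: C_def ball_const_def G_def)
  qed
  define x where "x = X powr (1 / P)"
  define y where "y = Y powr (1 / P)"
  have xy: "0 < x" "0 < y" "x powr P = X" "y powr P = Y" "ln x = ln X / P" "ln y = ln Y / P"
    using XY nz by (simp_all add: x_def y_def powr_powr ln_powr)
  have "D * \<rho> = P * (ln \<theta> - ln (1 - \<theta>)) - ln N - ln C / 2 + ln S"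
    using nz by (simp add: \<rho>_def)
  then have "ln X - ln Y = P * (ln \<theta> - ln (1 - \<theta>))"
    by (simp add: lX lY D_def field_simps)
  then have "ln (1 - \<theta>) + ln x = ln \<theta> + ln y"
    using nz by (simp add: xy field_simps)
  then have lxy: "ln (x + y) = \<theta> * (ln x - ln \<theta>) + (1 - \<theta>) * (ln y - ln (1 - \<theta>))"
    using xy \<theta> by (intro ln_add_eq_weighted_ln) auto
  have "(X + Y) powr p \<le> ((x + y) powr P) powr p"
    using powr_add_le_add_powr [of x y P] xy p XY by (intro powr_mono2) (auto simp: P_def)
  also have "\<dots> = exp (p * P * ln (x + y))"
    using xy by (simp add: powr_powr powr_def mult_ac)
  \<comment> \<open>Both sides are linear in the logarithms, so coefficients can be compared. The
    terms in \<rho> cancel without unfolding it: their coefficient is proportional to \<theta> (2d -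
    \<epsilon>) - 2 \<epsilon> (1 - \<theta>) = 0, the stationarity condition.\<close>
  also have "p * P * ln (x + y) = p * P * (ln D - \<epsilon> * (2 * d + 2 * p + 2) / (D * P) * ln 2
      - 2 * \<epsilon> / D * ln \<epsilon> - \<epsilon> / (D * P) * G - ((2 * d - \<epsilon>) / D + \<epsilon> / (D * P)) * ln (2 * d - \<epsilon>))
      + 4 * p * d / D * ln S + p * (p - (2 * d - \<epsilon>) / D) * ln N"
    using nz(1,2) unfolding lxy xy(5,6) lX lY l\<theta> lC unfolding \<theta>(3) unfolding \<theta>_def d p'
    by (simp add: field_simps)
  also have "exp \<dots> = M_const d \<epsilon> p * S powr (4 * p * d / (2 * d + \<epsilon>)) * N powr (p * (p - (2 * d - \<epsilon>) / (2 * d + \<epsilon>)))"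
    using nz \<epsilon> pos unfolding M_const_def powr_def D_def P_def
    by (simp add: exp_add exp_diff exp_minus ln_mult ln_div G_def Gamma_nz)
  finally show thesis
    using that [of r] nz by (simp add: X_def Y_def)
qed

section \<open>Integral estimates inside and outside the ball, and on the set\<close>

lemma nn_integral_Lyapunov:
  fixes u :: "'a \<Rightarrow> real" and p m K :: real
  assumes [measurable]: "u \<in> borel_measurable M" "E \<in> sets M"
    and u: "\<And>x. 0 \<le> u x" and pos: "0 < p" "0 < m" "0 < K"
    and m: "emeasure M E = ennreal m"
    and K: "(\<integral>\<^sup>+x. indicator E x * ennreal (u x powr (p + 1)) \<partial>M) \<le> ennreal K"
  shows "(\<integral>\<^sup>+x. indicator E x * ennreal (u x powr p) \<partial>M)
    \<le> ennreal (m powr (1 / (p + 1)) * K powr (p / (p + 1)))"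
proof -
  define \<alpha> \<beta> where "\<alpha> = p / (p + 1)" and "\<beta> = 1 / (p + 1)"
  have ab: "0 < \<alpha>" "0 < \<beta>" "\<alpha> + \<beta> = 1" "p * \<beta> = \<alpha>" "(p + 1) * \<alpha> = p"
    using pos by (auto simp: \<alpha>_def \<beta>_def field_simps)
  \<comment> \<open>This value makes \<open>l * K\<close> and \<open>l powr (- p) * m\<close> equal,
    so the weighted sum of the two terms below collapses to the Hoelder bound.\<close>
  define l where "l = (m / K) powr \<beta>"
  have l: "0 < l"
    using pos by (simp add: l_def)
  \<comment> \<open>Hoelder's inequality is obtained by integrating a pointwise weighted Young
    inequality with a free scale \<open>l\<close>, whose powers cancel in the geometric
    mean.\<close>
  have young: "u x powr p \<le> \<alpha> * l * u x powr (p + 1) + \<beta> * l powr (- p)" for x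
  proof (cases "u x = 0")
    case False
    then have ux: "0 < u x"
      using u [of x] by simp
    have "(l powr (- p)) powr \<beta> = l powr (- \<alpha>)"
      using ab by (simp add: powr_powr)
    then have "(l * u x powr (p + 1)) powr \<alpha> * (l powr (- p)) powr \<beta> = u x powr p"
      using l ux ab by (simp add: powr_mult powr_powr powr_minus)
    then show ?thesis
      using Youngs_inequality_0 [of \<alpha> \<beta> "l * u x powr (p + 1)" "l powr (- p)"] ab l ux by simp
  qed (use ab l pos in simp)
  have "(\<integral>\<^sup>+x. indicator E x * ennreal (u x powr p) \<partial>M)
      \<le> (\<integral>\<^sup>+x. ennreal (\<alpha> * l) * (indicator E x * ennreal (u x powr (p + 1)))
          + ennreal (\<beta> * l powr (- p)) * indicator E x \<partial>M)"
  proof (rule nn_integral_mono)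
    fix x
    show "indicator E x * ennreal (u x powr p) \<le> ennreal (\<alpha> * l) * (indicator E x * ennreal (u x powr (p + 1)))
          + ennreal (\<beta> * l powr (- p)) * indicator E x"
      using young [of x] ab l
      by (auto simp: indicator_def intro!: ennreal_leI simp flip: ennreal_mult ennreal_plus)
  qed
  also have "\<dots> = ennreal (\<alpha> * l) * (\<integral>\<^sup>+x. indicator E x * ennreal (u x powr (p + 1)) \<partial>M)
      + ennreal (\<beta> * l powr (- p)) * emeasure M E"
    by (subst nn_integral_add) (simp_all add: nn_integral_cmult)
  also have "\<dots> \<le> ennreal (\<alpha> * l) * ennreal K + ennreal (\<beta> * l powr (- p)) * ennreal m"
    unfolding m by (intro add_right_mono mult_left_mono K) simp
  also have "\<dots> = ennreal (\<alpha> * (l * K) + \<beta> * (l powr (- p) * m))"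
    using ab l pos by (simp add: mult_ac flip: ennreal_mult ennreal_plus)
  also have "l * K = m powr \<beta> * K powr \<alpha>"
  proof -
    have "\<alpha> = 1 - \<beta>"
      using ab by simp
    then show ?thesis
      using pos by (simp add: l_def powr_divide powr_diff)
  qed
  also have "l powr (- p) * m = m powr \<beta> * K powr \<alpha>"
  proof -
    have b: "\<beta> = 1 - \<alpha>" "\<beta> * p = \<alpha>"
      using ab by (simp_all add: mult.commute)
    have l_powr: "l powr (- p) = (m / K) powr (- \<alpha>)"
      using b by (simp add: l_def powr_powr)
    show ?thesis
      using pos unfolding l_powr b(1) by (simp add: powr_divide powr_minus powr_diff field_simps)
  qed
  also have "\<alpha> * (m powr \<beta> * K powr \<alpha>) + \<beta> * (m powr \<beta> * K powr \<alpha>) = m powr \<beta> * K powr \<alpha>"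
    using ab by (simp flip: distrib_right)
  finally show ?thesis
    by (simp add: \<alpha>_def \<beta>_def)
qed

lemma nn_integral_powr_inner_bound:
  fixes A :: "'a::euclidean_space \<Rightarrow> 'b::{real_normed_vector, second_countable_topology}"
  assumes A: "A \<in> borel_measurable borel" and N: "\<And>z. norm (A z) \<le> N" "0 < N"
    and d: "real DIM('a) = 4 * d" and \<epsilon>: "0 < \<epsilon>" "\<epsilon> < 2 * d" and p: "1 \<le> p" and r: "0 < r"
    and S: "(\<integral>\<^sup>+z. ennreal (norm z powr (2 * \<epsilon>) * (norm (A z))\<^sup>2) \<partial>mu) = ennreal (S\<^sup>2)" "0 \<le> S"
  shows "(\<integral>\<^sup>+z. indicator (cball 0 r) z * ennreal (norm (A z) powr (p + 1)) \<partial>mu)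
    \<le> ennreal (inner_bound d \<epsilon> p N S r)"
proof -
  note [measurable] = A
  have [measurable]: "cball (0::'a) r \<in> sets borel"
    by simp
  have lb: "F \<in> borel_measurable mu" if "F \<in> borel_measurable borel" for F :: "'a \<Rightarrow> ennreal"
    using that by (simp add: measurable_completion cong: measurable_cong_sets [OF sets_mu refl])
  have sq: "(a powr b)\<^sup>2 = a powr (2 * b)" for a b :: real
    by (simp add: power2_eq_square flip: powr_add)
  define C where "C = ball_const d \<epsilon> * r powr (4 * d - 2 * \<epsilon>)"
  have "0 < d"
    using \<epsilon> by simp
  then have C: "0 \<le> C"
    using ball_const_pos [of d \<epsilon>] \<epsilon> by (simp add: C_def)
  define F where "F = (\<lambda>z::'a. indicator (cball 0 r) z * ennreal (norm z powr (- \<epsilon>)))"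
  define G where "G = (\<lambda>z. ennreal (norm z powr \<epsilon> * norm (A z)))"
  \<comment> \<open>The weights |z|^(-\<epsilon>) and |z|^\<epsilon> multiply to 1 except at the
    origin, where both are 0 by the convention for \<open>powr\<close>.\<close>
  have "AE z in lebesgue. z \<noteq> (0::'a)"
    by (intro AE_completion AE_lborel_singleton)
  then have nonzero: "AE z in mu. z \<noteq> (0::'a)"
    by (simp only: AE_mu_iff)
  have "(\<integral>\<^sup>+z. indicator (cball 0 r) z * ennreal (norm (A z) powr (p + 1)) \<partial>mu)
      \<le> (\<integral>\<^sup>+z. ennreal (N powr p) * (F z * G z) \<partial>mu)"
  proof (rule nn_integral_mono_AE)
    show "AE z in mu. indicator (cball 0 r) z * ennreal (norm (A z) powr (p + 1))
        \<le> ennreal (N powr p) * (F z * G z)"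
      using nonzero
    proof eventually_elim
      case (elim z)
      have "norm (A z) powr (p + 1) \<le> N powr p * norm (A z)"
      proof -
        have "norm (A z) powr (p + 1) = norm (A z) powr p * norm (A z)"
          using powr_mult_base [of "norm (A z)" p] by (simp add: ac_simps)
        also have "\<dots> \<le> N powr p * norm (A z)"
          using N p by (intro mult_right_mono powr_mono2) auto
        finally show ?thesis .
      qed
      also have "N powr p * norm (A z) = N powr p * (norm z powr (- \<epsilon>) * (norm z powr \<epsilon> * norm (A z)))"
        using elim by (simp add: powr_minus field_simps)
      finally show ?case
        by (auto simp: F_def G_def indicator_def intro!: ennreal_leI simp flip: ennreal_mult)
    qed
  qed
  also have "\<dots> = ennreal (N powr p) * (\<integral>\<^sup>+z. F z * G z \<partial>mu)"
    by (intro nn_integral_cmult lb) (simp add: F_def G_def)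
  also have "(\<integral>\<^sup>+z. F z * G z \<partial>mu) \<le> ennreal (sqrt C * S)"
  proof (rule ennreal_le_of_power2_le)
    have "(\<integral>\<^sup>+z. F z * G z \<partial>mu)\<^sup>2 \<le> (\<integral>\<^sup>+z. (F z)\<^sup>2 \<partial>mu) * (\<integral>\<^sup>+z. (G z)\<^sup>2 \<partial>mu)"
      by (intro Cauchy_Schwarz_nn_integral lb) (simp_all add: F_def G_def)
    also have "(\<lambda>z. (F z)\<^sup>2) = (\<lambda>z. indicator (cball 0 r) z * ennreal (norm z powr (- (2 * \<epsilon>))))"
      by (auto simp: F_def indicator_def fun_eq_iff ennreal_power sq)
    also have "(\<lambda>z. (G z)\<^sup>2) = (\<lambda>z. ennreal (norm z powr (2 * \<epsilon>) * (norm (A z))\<^sup>2))"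
      by (auto simp: G_def fun_eq_iff ennreal_power power_mult_distrib sq)
    also have "(\<integral>\<^sup>+z. indicator (cball (0::'a) r) z * ennreal (norm z powr (- (2 * \<epsilon>))) \<partial>mu) = ennreal C"
      unfolding C_def by (rule nn_integral_mu_cball_norm_powr [OF d \<epsilon> r])
    also have "ennreal C * (\<integral>\<^sup>+z. ennreal (norm z powr (2 * \<epsilon>) * (norm (A z))\<^sup>2) \<partial>mu) = ennreal ((sqrt C * S)\<^sup>2)"
      unfolding S(1) using C by (simp add: power_mult_distrib ennreal_mult)
    finally show "(\<integral>\<^sup>+z. F z * G z \<partial>mu)\<^sup>2 \<le> ennreal ((sqrt C * S)\<^sup>2)" .
  qed (use C S in simp)
  also have "ennreal (N powr p) * ennreal (sqrt C * S) = ennreal (inner_bound d \<epsilon> p N S r)"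
    using C S by (simp add: inner_bound_def C_def ennreal_mult)
  finally show ?thesis
    by (simp add: mult_left_mono)
qed

text \<open>Two of the p + 1 factors |A| are kept for the weighted square integral, and the
  remaining power p - 1, nonnegative since p is at least 1, is bounded through \<open>N\<close>.
  Outside the ball (|z|/r)^(2 \<epsilon>) is at least 1, which inserts the weight.\<close>

lemma nn_integral_powr_outer_bound:
  fixes A :: "'a::euclidean_space \<Rightarrow> 'b::{real_normed_vector, second_countable_topology}"
  assumes A: "A \<in> borel_measurable borel" and N: "\<And>z. norm (A z) \<le> N" "0 < N"
    and \<epsilon>: "0 < \<epsilon>" and p: "1 \<le> p" and r: "0 < r"
    and S: "(\<integral>\<^sup>+z. ennreal (norm z powr (2 * \<epsilon>) * (norm (A z))\<^sup>2) \<partial>mu) = ennreal (S\<^sup>2)" "0 \<le> S"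
  shows "(\<integral>\<^sup>+z. indicator (- cball 0 r) z * ennreal (norm (A z) powr (p + 1)) \<partial>mu)
    \<le> ennreal (outer_bound \<epsilon> p N S r)"
proof -
  note [measurable] = A
  have lb: "F \<in> borel_measurable mu" if "F \<in> borel_measurable borel" for F :: "'a \<Rightarrow> ennreal"
    using that by (simp add: measurable_completion cong: measurable_cong_sets [OF sets_mu refl])
  define c where "c = N powr (p - 1) * r powr (- (2 * \<epsilon>))"
  have "(\<integral>\<^sup>+z. indicator (- cball 0 r) z * ennreal (norm (A z) powr (p + 1)) \<partial>mu)
      \<le> (\<integral>\<^sup>+z. ennreal c * ennreal (norm z powr (2 * \<epsilon>) * (norm (A z))\<^sup>2) \<partial>mu)"
  proof (rule nn_integral_mono)
    fix z :: 'a
    have "norm (A z) powr (p + 1) \<le> c * (norm z powr (2 * \<epsilon>) * (norm (A z))\<^sup>2)" if "r < norm z"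
    proof -
      have "norm (A z) powr (p + 1) = norm (A z) powr (p - 1) * (norm (A z))\<^sup>2"
        by (simp flip: powr_add powr_numeral) (simp add: add.commute)
      also have "\<dots> \<le> N powr (p - 1) * (norm (A z))\<^sup>2"
        using N p by (intro mult_right_mono powr_mono2) auto
      also have "\<dots> \<le> N powr (p - 1) * ((r powr (- (2 * \<epsilon>)) * norm z powr (2 * \<epsilon>)) * (norm (A z))\<^sup>2)"
      proof -
        have "r powr (2 * \<epsilon>) \<le> norm z powr (2 * \<epsilon>)"
          using that r \<epsilon> by (intro powr_mono2) auto
        then have "1 \<le> r powr (- (2 * \<epsilon>)) * norm z powr (2 * \<epsilon>)"
          using r by (simp add: powr_minus field_simps)
        then show ?thesis
          using mult_right_mono [of 1 _ "(norm (A z))\<^sup>2"] by (intro mult_left_mono) simp_all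
      qed
      finally show ?thesis
        by (simp add: c_def ac_simps)
    qed
    then show "indicator (- cball 0 r) z * ennreal (norm (A z) powr (p + 1))
        \<le> ennreal c * ennreal (norm z powr (2 * \<epsilon>) * (norm (A z))\<^sup>2)"
      by (auto simp: indicator_def c_def intro!: ennreal_leI simp flip: ennreal_mult)
  qed
  also have "\<dots> = ennreal c * ennreal (S\<^sup>2)"
    unfolding S(1) [symmetric] by (intro nn_integral_cmult lb) simp
  also have "\<dots> = ennreal (outer_bound \<epsilon> p N S r)"
    by (simp add: outer_bound_def c_def ennreal_mult)
  finally show ?thesis .
qed

text \<open>The bounds inside and outside the optimal ball add up to \<open>K\<close>. Raising
  m^(1/(p+1)) K^(p/(p+1)) to the power p + 1 gives m K^p, and the choice of radius controls
  K^p.\<close>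

lemma nn_integral_powr_bound:
  fixes A :: "'a::euclidean_space \<Rightarrow> 'b::{real_normed_vector, second_countable_topology}"
  assumes A: "A \<in> borel_measurable borel" and N: "\<And>z. norm (A z) \<le> N" "0 < N"
    and d: "real DIM('a) = 4 * d" and \<epsilon>: "0 < \<epsilon>" "\<epsilon> < 2 * d" and p: "1 \<le> p"
    and S: "(\<integral>\<^sup>+z. ennreal (norm z powr (2 * \<epsilon>) * (norm (A z))\<^sup>2) \<partial>mu) = ennreal (S\<^sup>2)" "0 < S"
    and \<Sigma>: "\<Sigma> \<in> sets lebesgue" "emeasure mu \<Sigma> = ennreal m" "0 < m"
  obtains I where "0 \<le> I" "(\<integral>\<^sup>+z. indicator \<Sigma> z * ennreal (norm (A z) powr p) \<partial>mu) = ennreal I"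
    "I powr (p + 1) \<le> m * (M_const d \<epsilon> p * S powr (4 * p * d / (2 * d + \<epsilon>)) * N powr (p * (p - (2 * d - \<epsilon>) / (2 * d + \<epsilon>))))"
proof -
  note [measurable] = A
  have lb: "F \<in> borel_measurable mu" if "F \<in> borel_measurable borel" for F :: "'a \<Rightarrow> 'c::topological_space"
    using that by (simp add: measurable_completion cong: measurable_cong_sets [OF sets_mu refl])
  have [measurable]: "cball (0::'a) r \<in> sets borel" for r
    by simp
  obtain r where r: "0 < r" and opt:
    "(inner_bound d \<epsilon> p N S r + outer_bound \<epsilon> p N S r) powr p
      \<le> M_const d \<epsilon> p * S powr (4 * p * d / (2 * d + \<epsilon>)) * N powr (p * (p - (2 * d - \<epsilon>) / (2 * d + \<epsilon>)))"
    using ex_optimal_radius [OF \<epsilon> p N(2) S(2)] .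
  define K where "K = inner_bound d \<epsilon> p N S r + outer_bound \<epsilon> p N S r"
  have "0 < d"
    using \<epsilon> by simp
  then have nonneg: "0 < inner_bound d \<epsilon> p N S r" "0 < outer_bound \<epsilon> p N S r"
    using ball_const_pos [of d \<epsilon>] \<epsilon> N S r by (simp_all add: inner_bound_def outer_bound_def)
  have K: "0 < K"
    using nonneg by (simp add: K_def)
  \<comment> \<open>For the exponent p + 1 the set is enlarged to the whole space. Its measure
    enters only afterwards, through \<open>nn_integral_Lyapunov\<close>.\<close>
  have "(\<integral>\<^sup>+z. indicator \<Sigma> z * ennreal (norm (A z) powr (p + 1)) \<partial>mu)
      \<le> (\<integral>\<^sup>+z. indicator (cball 0 r) z * ennreal (norm (A z) powr (p + 1))
          + indicator (- cball 0 r) z * ennreal (norm (A z) powr (p + 1)) \<partial>mu)"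
    by (intro nn_integral_mono) (auto simp: indicator_def)
  also have "\<dots> = (\<integral>\<^sup>+z. indicator (cball 0 r) z * ennreal (norm (A z) powr (p + 1)) \<partial>mu)
      + (\<integral>\<^sup>+z. indicator (- cball 0 r) z * ennreal (norm (A z) powr (p + 1)) \<partial>mu)"
    by (intro nn_integral_add lb) simp_all
  also have "\<dots> \<le> ennreal (inner_bound d \<epsilon> p N S r) + ennreal (outer_bound \<epsilon> p N S r)"
    using S by (intro add_mono nn_integral_powr_inner_bound nn_integral_powr_outer_bound A N d \<epsilon> p r) auto
  also have "\<dots> = ennreal K"
    using nonneg by (simp add: K_def)
  finally have "(\<integral>\<^sup>+z. indicator \<Sigma> z * ennreal (norm (A z) powr p) \<partial>mu)
      \<le> ennreal (m powr (1 / (p + 1)) * K powr (p / (p + 1)))"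
    using p K \<Sigma> by (intro nn_integral_Lyapunov lb) (auto simp: sets_mu)
  then obtain I where I: "0 \<le> I" "(\<integral>\<^sup>+z. indicator \<Sigma> z * ennreal (norm (A z) powr p) \<partial>mu) = ennreal I"
      "I \<le> m powr (1 / (p + 1)) * K powr (p / (p + 1))"
    using K \<Sigma> by (cases "\<integral>\<^sup>+z. indicator \<Sigma> z * ennreal (norm (A z) powr p) \<partial>mu") (auto simp: top_unique)
  have "I powr (p + 1) \<le> (m powr (1 / (p + 1)) * K powr (p / (p + 1))) powr (p + 1)"
    using I p by (intro powr_mono2) auto
  also have "\<dots> = m * K powr p"
    using \<Sigma>(3) K p by (simp add: powr_mult powr_powr)
  also have "\<dots> \<le> m * (M_const d \<epsilon> p * S powr (4 * p * d / (2 * d + \<epsilon>)) * N powr (p * (p - (2 * d - \<epsilon>) / (2 * d + \<epsilon>))))"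
    using opt \<Sigma>(3) unfolding K_def by (intro mult_left_mono) auto
  finally show thesis
    using that I by blast
qed

text \<open>The weight is positive off the origin, a null set. This covers the degenerate case of a
  vanishing weighted norm, which has no optimal radius.\<close>

lemma AE_eq_0_of_weighted_norm_eq_0:
  fixes A :: "'a::euclidean_space \<Rightarrow> 'b::{real_normed_vector, second_countable_topology}"
  assumes [measurable]: "A \<in> borel_measurable borel"
    and 0: "(\<integral>\<^sup>+z. ennreal (norm z powr a * (norm (A z))\<^sup>2) \<partial>mu) = 0"
  shows "AE z in mu. A z = 0"
proof -
  have "(\<lambda>z. ennreal (norm z powr a * (norm (A z))\<^sup>2)) \<in> borel_measurable borel"
    by measurable
  then have "(\<lambda>z. ennreal (norm z powr a * (norm (A z))\<^sup>2)) \<in> borel_measurable mu"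
    by (simp add: measurable_completion cong: measurable_cong_sets [OF sets_mu refl])
  then have ae: "AE z in mu. ennreal (norm z powr a * (norm (A z))\<^sup>2) = 0"
    using 0 by (simp add: nn_integral_0_iff_AE)
  have "AE z in lebesgue. z \<noteq> (0::'a)"
    by (intro AE_completion AE_lborel_singleton)
  then have "AE z in mu. z \<noteq> (0::'a)"
    by (simp only: AE_mu_iff)
  with ae show ?thesis
  proof eventually_elim
    case (elim z)
    then have "norm z powr a * (norm (A z))\<^sup>2 = 0"
      by (metis ennreal_eq_0_iff mult_nonneg_nonneg powr_ge_zero zero_le_power2 order_antisym)
    then show ?case
      using elim by simp
  qed
qed

section \<open>Degenerate cases and assembly of the theorem\<close>

lemma M_const_nonneg: "0 \<le> M_const d \<epsilon> p"
  by (simp add: M_const_def)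

theorem corollary14:
  fixes \<epsilon> p d :: real
  assumes d: "d = real CARD('d::finite)"
    and eps: "0 < \<epsilon>" "\<epsilon> < 2 * d"
    and p: "p \<ge> 1"
  shows "\<exists>M::real. M \<ge> 0 \<and> M = M_const d \<epsilon> p \<and>
    (\<forall>(g :: (real^'d) \<times> (real^'d) \<Rightarrow> quaternion) (f :: (real^'d) \<times> (real^'d) \<Rightarrow> quaternion)
       (\<Sigma> :: (((real^'d) \<times> (real^'d)) \<times> ((real^'d) \<times> (real^'d))) set).
       quaternion_window g \<longrightarrow> in_L2 f \<longrightarrow> \<Sigma> \<in> sets lebesgue \<longrightarrow> emeasure mu \<Sigma> < \<infinity> \<longrightarrow>
       ennpowr (Lp_norm p (\<lambda>z. indicat_real \<Sigma> z *\<^sub>R ambiguity f g z)) (p * (p + 1))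
       \<le> ennreal M * emeasure mu \<Sigma>
          * ennpowr (Lp_norm 2 (\<lambda>z. norm z powr \<epsilon> *\<^sub>R ambiguity f g z)) (4 * p * d / (2 * d + \<epsilon>))
          * ennpowr (Lp_norm 2 f * Lp_norm 2 g) (p * (p - (2 * d - \<epsilon>) / (2 * d + \<epsilon>))))"
proof (intro exI [of _ "M_const d \<epsilon> p"] conjI allI impI M_const_nonneg refl)
  fix g f :: "(real^'d) \<times> (real^'d) \<Rightarrow> quaternion"
    and \<Sigma> :: "(((real^'d) \<times> (real^'d)) \<times> ((real^'d) \<times> (real^'d))) set"
  assume gw: "quaternion_window g" and f2: "in_L2 f" and \<Sigma>: "\<Sigma> \<in> sets lebesgue" "emeasure mu \<Sigma> < \<infinity>"
  define A where "A = ambiguity f g"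
  have fg: "f \<in> borel_measurable lebesgue" "g \<in> borel_measurable lebesgue"
    and fin: "Lp_norm 2 f < \<infinity>" "Lp_norm 2 g < \<infinity>"
    using gw f2 by (auto simp: quaternion_window_def in_L2_def)
  have A: "A \<in> borel_measurable borel"
    unfolding A_def using fg by (rule borel_measurable_ambiguity)
  define I where "I = (\<integral>\<^sup>+z. indicator \<Sigma> z * ennreal (norm (A z) powr p) \<partial>mu)"
  \<comment> \<open>The exponents 1/p and p (p + 1) combine to p + 1, also when \<open>I\<close> is
    infinite.\<close>
  have lhs: "ennpowr (Lp_norm p (\<lambda>z. indicat_real \<Sigma> z *\<^sub>R A z)) (p * (p + 1)) = ennpowr I (p + 1)"
  proof -
    have "(\<lambda>z. ennreal (norm (indicat_real \<Sigma> z *\<^sub>R A z) powr p)) = (\<lambda>z. indicator \<Sigma> z * ennreal (norm (A z) powr p))"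
      by (auto simp: indicator_def fun_eq_iff)
    then have "Lp_norm p (\<lambda>z. indicat_real \<Sigma> z *\<^sub>R A z) = ennpowr I (1 / p)"
      by (simp add: Lp_norm_def I_def)
    then show ?thesis
      using p by (cases I) (simp_all add: ennpowr_def powr_powr)
  qed
  have I0: "ennpowr I (p + 1) \<le> R" if "AE z in mu. z \<in> \<Sigma> \<longrightarrow> A z = 0" for R
  proof -
    have "I = (\<integral>\<^sup>+z. 0 \<partial>(mu :: (((real^'d) \<times> (real^'d)) \<times> ((real^'d) \<times> (real^'d))) measure))"
      unfolding I_def using that
      by (intro nn_integral_cong_AE) (auto elim!: eventually_mono simp: indicator_def)
    then show ?thesis
      by (simp add: ennpowr_def)
  qed
  define T where "T = Lp_norm 2 (\<lambda>z. norm z powr \<epsilon> *\<^sub>R A z)"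
  obtain N where N: "0 \<le> N" "Lp_norm 2 f * Lp_norm 2 g = ennreal N"
    using fin by (cases "Lp_norm 2 f * Lp_norm 2 g") (auto simp: ennreal_mult_eq_top_iff)
  obtain m where m: "0 \<le> m" "emeasure mu \<Sigma> = ennreal m"
    using \<Sigma>(2) by (cases "emeasure mu \<Sigma>") auto
  have AN: "norm (A z) \<le> N" for z
    using norm_ambiguity_le [OF fg, of z] N by (simp add: A_def)
  have ratio: "(2 * d - \<epsilon>) / (2 * d + \<epsilon>) < 1"
    using eps by simp
  have sq: "norm (norm z powr \<epsilon> *\<^sub>R A z) powr 2 = norm z powr (2 * \<epsilon>) * (norm (A z))\<^sup>2" for z
    by (simp add: power_mult_distrib power2_eq_square flip: powr_add)
  \<comment> \<open>Strict positivity is needed when the weighted norm is infinite: otherwise 0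
    times infinity would make the right-hand side 0.\<close>
  have M: "0 < M_const d \<epsilon> p"
  proof -
    have "0 < Gamma (2 * d)"
      using eps by simp
    then have "Gamma (2 * d) \<noteq> 0"
      by linarith
    then show ?thesis
      using eps by (simp add: M_const_def)
  qed
  have "ennpowr I (p + 1) \<le> ennreal (M_const d \<epsilon> p) * emeasure mu \<Sigma> * ennpowr T (4 * p * d / (2 * d + \<epsilon>))
      * ennpowr (Lp_norm 2 f * Lp_norm 2 g) (p * (p - (2 * d - \<epsilon>) / (2 * d + \<epsilon>)))"
  proof -
    \<comment> \<open>If \<open>m\<close>, \<open>N\<close> or \<open>T\<close> is 0, the right-hand
      side is 0, possibly as 0 times infinity, so the left-hand side must vanish. It does, because A
      = 0 almost everywhere on \<Sigma>. If \<open>T\<close> is infinite and \<open>m\<close>,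
      \<open>N\<close> are positive, the right-hand side is infinite. Only the last case needs the
      estimates.\<close>
    consider "m = 0" | "N = 0" | "0 < m" "0 < N" "T = \<infinity>" | "T = 0"
      | S where "0 < m" "0 < N" "T = ennreal S" "0 < S"
      using m N by (cases T) (auto simp: less_le)
    then show ?thesis
    proof cases
      case 1
      then have "\<Sigma> \<in> null_sets mu"
        using m \<Sigma> by (auto simp: null_sets_def sets_mu)
      then show ?thesis
        by (intro I0) (auto dest: AE_not_in)
    next
      case 2
      then show ?thesis
        using AN by (intro I0) simp
    next
      case 3
      then show ?thesis
        using M m N by (simp add: ennpowr_def ennreal_mult_top ennreal_top_mult)
    next
      case 4
      then have "(\<integral>\<^sup>+z. ennreal (norm z powr (2 * \<epsilon>) * (norm (A z))\<^sup>2) \<partial>mu) = 0"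
        using Lp_norm_eq_ennreal_iff [of 2 0 "\<lambda>z. norm z powr \<epsilon> *\<^sub>R A z", unfolded sq] by (simp add: T_def)
      from AE_eq_0_of_weighted_norm_eq_0 [OF A this] show ?thesis
        by (intro I0) (auto elim: eventually_mono)
    next
      case 5
      have S: "(\<integral>\<^sup>+z. ennreal (norm z powr (2 * \<epsilon>) * (norm (A z))\<^sup>2) \<partial>mu) = ennreal (S\<^sup>2)"
        using Lp_norm_eq_ennreal_iff [of 2 S "\<lambda>z. norm z powr \<epsilon> *\<^sub>R A z", unfolded sq] 5 by (simp add: T_def)
      have dim: "real DIM(((real^'d) \<times> (real^'d)) \<times> ((real^'d) \<times> (real^'d))) = 4 * d"
        by (simp add: d)
      obtain J where "0 \<le> J" "I = ennreal J"
        "J powr (p + 1) \<le> m * (M_const d \<epsilon> p * S powr (4 * p * d / (2 * d + \<epsilon>)) * N powr (p * (p - (2 * d - \<epsilon>) / (2 * d + \<epsilon>))))"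
        using nn_integral_powr_bound [OF A AN \<open>0 < N\<close> dim eps p S \<open>0 < S\<close> \<Sigma>(1) m(2) \<open>0 < m\<close>]
        unfolding I_def .
      then show ?thesis
        using M 5 N m by (simp add: ennpowr_def ac_simps flip: ennreal_mult)
    qed
  qed
  then show "ennpowr (Lp_norm p (\<lambda>z. indicat_real \<Sigma> z *\<^sub>R ambiguity f g z)) (p * (p + 1))
       \<le> ennreal (M_const d \<epsilon> p) * emeasure mu \<Sigma>
          * ennpowr (Lp_norm 2 (\<lambda>z. norm z powr \<epsilon> *\<^sub>R ambiguity f g z)) (4 * p * d / (2 * d + \<epsilon>))
          * ennpowr (Lp_norm 2 f * Lp_norm 2 g) (p * (p - (2 * d - \<epsilon>) / (2 * d + \<epsilon>)))"
    using lhs by (simp add: A_def T_def)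
qed

end
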